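(* For every positive integer $\omega$, there exists a split graph $G$ with $\omega(G)=\omega$ such that $\overrightarrow{\chi}(G)=2\omega-2$.
   Context: An orientation $D$ of a graph $G$ replaces each edge by exactly one of its two possible arcs; $d^-_D(v)$ is the indegree of $v$. $D$ is proper if adjacent vertices have distinct indegrees; a $k$-orientation has maximum indegree at most $k$. $\overrightarrow{\chi}(G)$ is the minimum $k$ such that $G$ admits a proper $k$-orientation; $\omega(G)$ is the clique number. A split graph is a graph whose vertex set can be partitioned into a clique and an independent set. *)

theory Defs
  imports "Graph_Theory.Pair_Digraph"
begin

text \<open>
  A finite simple graph is a \<^locale>\<open>pair_graph\<close>: a finite loop-free digraph without parallel
  arcs whose arc relation is symmetric, an edge \<open>uv\<close> being the pair of arcs
  \<open>(u, v)\<close> and \<open>(v, u)\<close>.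
\<close>

definition clique_in :: "'a pair_pre_digraph \<Rightarrow> 'a set \<Rightarrow> bool" where
  "clique_in G K \<longleftrightarrow> K \<subseteq> pverts G \<and> (\<forall>u\<in>K. \<forall>v\<in>K. u \<noteq> v \<longrightarrow> (u, v) \<in> parcs G)"

definition independent_in :: "'a pair_pre_digraph \<Rightarrow> 'a set \<Rightarrow> bool" where
  "independent_in G S \<longleftrightarrow> S \<subseteq> pverts G \<and> (\<forall>u\<in>S. \<forall>v\<in>S. (u, v) \<notin> parcs G)"

definition clique_number :: "'a pair_pre_digraph \<Rightarrow> nat" where
  "clique_number G = Max {card K | K. clique_in G K}"

definition split_graph :: "'a pair_pre_digraph \<Rightarrow> bool" where
  "split_graph G \<longleftrightarrow> pair_graph G \<and>
     (\<exists>K S. clique_in G K \<and> independent_in G S \<and> K \<union> S = pverts G \<and> K \<inter> S = {})"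

text \<open>The inequality of truth values says that exactly one of the two arcs is chosen.\<close>

definition orientation_of :: "'a pair_pre_digraph \<Rightarrow> 'a pair_pre_digraph \<Rightarrow> bool" where
  "orientation_of G D \<longleftrightarrow> pverts D = pverts G \<and> parcs D \<subseteq> parcs G \<and>
     (\<forall>u v. (u, v) \<in> parcs G \<longrightarrow> ((u, v) \<in> parcs D) \<noteq> ((v, u) \<in> parcs D))"

definition proper_orientation :: "'a pair_pre_digraph \<Rightarrow> 'a pair_pre_digraph \<Rightarrow> bool" where
  "proper_orientation G D \<longleftrightarrow> orientation_of G D \<and>
     (\<forall>u v. (u, v) \<in> parcs G \<longrightarrow> in_degree D u \<noteq> in_degree D v)"

definition k_orientation :: "nat \<Rightarrow> 'a pair_pre_digraph \<Rightarrow> 'a pair_pre_digraph \<Rightarrow> bool" where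
  "k_orientation k G D \<longleftrightarrow> orientation_of G D \<and> (\<forall>v\<in>pverts G. in_degree D v \<le> k)"

text \<open>
  The minimum exists for every finite simple graph: orienting all edges at a vertex of maximum
  degree towards it, deleting that vertex and iterating gives a proper orientation.
\<close>

definition proper_orientation_number :: "'a pair_pre_digraph \<Rightarrow> nat" where
  "proper_orientation_number G = (LEAST k. \<exists>D. proper_orientation G D \<and> k_orientation k G D)"

end

theory Submission
  imports Defs
begin

text \<open>
  To every proper subset \<open>T\<close> of a clique \<open>K\<close> of size \<open>\<omega>\<close> attach many independent vertices with
  neighbourhood \<open>T\<close>. If indegrees are at most \<open>k < 2\<omega> - 2\<close>, the clique receives few arcs, so for
  every \<open>T\<close> one of these vertices is a sink of indegree \<open>|T|\<close>. Hence no clique vertex has an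
  indegree in \<open>{1..\<omega> - 1}\<close>, and at most \<open>\<omega> - 1\<close> values remain for the \<open>\<omega>\<close> distinct indegrees on
  \<open>K\<close>. Conversely, orienting \<open>K\<close> transitively and directing \<open>\<omega> - 1\<close> leaves towards every clique
  vertex but the source gives the clique the indegrees \<open>0\<close> and \<open>\<omega>, \<dots>, 2\<omega> - 2\<close>.
\<close>

text \<open>
  \<open>hang w T j\<close> is the \<open>j\<close>-th independent vertex with neighbourhood \<open>T\<close>; \<^const>\<open>set_encode\<close> is
  injective only on finite sets.
\<close>

definition hang :: "nat \<Rightarrow> nat set \<Rightarrow> nat \<Rightarrow> nat" where
  "hang w T j = w + prod_encode (set_encode T, j)"

text \<open>Only proper subsets serve as neighbourhoods: a vertex joined to all of
  \<open>{..<w}\<close> would create a clique of size \<open>w + 1\<close>.\<close>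

definition hangs :: "nat \<Rightarrow> nat \<Rightarrow> nat set" where
  "hangs w N = (\<lambda>(T, j). hang w T j) ` ({T. T \<subset> {..<w}} \<times> {..<N})"

definition hang_arcs :: "nat \<Rightarrow> nat \<Rightarrow> (nat \<times> nat) set" where
  "hang_arcs w N = {(u, hang w T j) | u T j. T \<subset> {..<w} \<and> j < N \<and> u \<in> T}"

definition hang_graph :: "nat \<Rightarrow> nat \<Rightarrow> nat pair_pre_digraph" where
  "hang_graph w N = \<lparr> pverts = {..<w} \<union> hangs w N,
     parcs = {(u, v). u < w \<and> v < w \<and> u \<noteq> v} \<union> hang_arcs w N \<union> (hang_arcs w N)\<inverse> \<rparr>"

text \<open>The leaves at \<open>u\<close> are the first \<open>w - 1\<close> copies with
  neighbourhood \<open>{u}\<close>. Vertex 0 is left out because it is the source of the transitive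
  tournament. The pairs point from clique to leaf, so the orientation contains their
  converse.\<close>

definition leaf_arcs :: "nat \<Rightarrow> (nat \<times> nat) set" where
  "leaf_arcs w = {(u, hang w {u} j) | u j. 1 \<le> u \<and> u < w \<and> j < w - 1}"

definition hang_orientation :: "nat \<Rightarrow> nat \<Rightarrow> nat pair_pre_digraph" where
  "hang_orientation w N = \<lparr> pverts = {..<w} \<union> hangs w N,
     parcs = {(u, v). u < v \<and> v < w} \<union> (hang_arcs w N - leaf_arcs w) \<union> (leaf_arcs w)\<inverse> \<rparr>"

section \<open>Encoding of the hanging vertices and their arcs\<close>

lemma hang_ge [simp]: "w \<le> hang w T j" "\<not> hang w T j < w"
  by (simp_all add: hang_def)

lemma hang_eq_iff:
  assumes "finite S" "finite T"
  shows "hang w S i = hang w T j \<longleftrightarrow> S = T \<and> i = j"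
  using assms by (simp add: hang_def set_encode_eq)

lemma psubset_lessThan_finite: "T \<subset> {..<w::nat} \<Longrightarrow> finite T"
  using finite_subset by blast

lemma card_psubset_lessThan: "T \<subset> {..<w::nat} \<Longrightarrow> card T < w"
  using psubset_card_mono[of "{..<w}" T] by simp

lemma in_degree_eq_card: "in_degree (with_proj D) v = card {u. (u, v) \<in> parcs D}"
proof -
  have "in_arcs (with_proj D) v = (\<lambda>u. (u, v)) ` {u. (u, v) \<in> parcs D}"
    by (auto simp: in_arcs_def)
  then show ?thesis
    by (simp add: in_degree_def card_image inj_on_def)
qed

lemma finite_hangs: "finite (hangs w N)"
proof -
  have "finite {T. T \<subset> {..<w}}"
    by (rule finite_subset[of _ "Pow {..<w}"]) auto
  then show ?thesis by (simp add: hangs_def)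
qed

lemma hangs_ge: "s \<in> hangs w N \<Longrightarrow> w \<le> s"
  by (auto simp: hangs_def)

lemma hang_arcsE:
  assumes "(u, s) \<in> hang_arcs w N"
  obtains T j where "s = hang w T j" "T \<subset> {..<w}" "j < N" "u \<in> T"
  using assms by (auto simp: hang_arcs_def)

lemma hang_arcs_hang_iff:
  assumes "T \<subset> {..<w}" "j < N"
  shows "(u, hang w T j) \<in> hang_arcs w N \<longleftrightarrow> u \<in> T"
proof
  assume "(u, hang w T j) \<in> hang_arcs w N"
  then obtain S i where "hang w T j = hang w S i" "S \<subset> {..<w}" "u \<in> S"
    by (rule hang_arcsE) auto
  then show "u \<in> T"
    using assms by (simp add: hang_eq_iff psubset_lessThan_finite)
qed (use assms in \<open>auto simp: hang_arcs_def\<close>)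

lemma hang_arcs_range: "(u, s) \<in> hang_arcs w N \<Longrightarrow> u < w \<and> w \<le> s \<and> s \<in> hangs w N"
  unfolding hang_arcs_def hangs_def by auto

lemma leaf_arcs_subset:
  assumes "w - 1 \<le> N"
  shows "leaf_arcs w \<subseteq> hang_arcs w N"
proof
  fix e assume "e \<in> leaf_arcs w"
  then obtain u j where "e = (u, hang w {u} j)" "1 \<le> u" "u < w" "j < w - 1"
    by (auto simp: leaf_arcs_def)
  \<comment> \<open>Vertex 0 is missing from \<open>{u}\<close> because \<open>u\<close> is
    positive, so \<open>{u}\<close> is a proper subset and its copies exist.\<close>
  moreover from this have "0 \<in> {..<w}" "0 \<notin> {u}" by auto
  then have "{u} \<subset> {..<w}" using \<open>u < w\<close> by blast
  ultimately show "e \<in> hang_arcs w N"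
    using assms by (simp add: hang_arcs_hang_iff)
qed

lemma leaf_arcs_range: "(u, s) \<in> leaf_arcs w \<Longrightarrow> u < w \<and> w \<le> s"
  by (auto simp: leaf_arcs_def)

section \<open>The split structure and the clique number\<close>

lemma pair_graph_hang_graph: "pair_graph (hang_graph w N)"
proof -
  have sub: "parcs (hang_graph w N) \<subseteq> pverts (hang_graph w N) \<times> pverts (hang_graph w N)"
    by (auto simp: hang_graph_def dest: hang_arcs_range)
  have fin: "finite (pverts (hang_graph w N))"
    by (simp add: hang_graph_def finite_hangs)
  show ?thesis
  proof
    show "finite (parcs (hang_graph w N))"
      using finite_subset[OF sub] fin by blast
    show "symmetric (with_proj (hang_graph w N))"
      by (auto simp: symmetric_def hang_graph_def sym_def)
    show "fst e \<noteq> snd e" if "e \<in> parcs (hang_graph w N)" for e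
      using that by (cases e) (auto simp: hang_graph_def dest: hang_arcs_range)
  qed (use sub fin in auto)
qed

lemma clique_in_hang_graph: "clique_in (hang_graph w N) {..<w}"
  by (auto simp: clique_in_def hang_graph_def)

lemma independent_in_hang_graph: "independent_in (hang_graph w N) (hangs w N)"
  by (fastforce simp: independent_in_def hang_graph_def dest: hang_arcs_range hangs_ge)

lemma split_graph_hang_graph: "split_graph (hang_graph w N)"
  unfolding split_graph_def
proof (intro conjI exI)
  show "{..<w} \<inter> hangs w N = {}" by (auto dest: hangs_ge)
qed (simp_all add: pair_graph_hang_graph clique_in_hang_graph independent_in_hang_graph,
     simp add: hang_graph_def)

text \<open>A clique leaving \<open>{..<w}\<close> contains a hanging vertex \<open>s\<close>. All
  its other members are neighbours of \<open>s\<close>, hence lie in a set \<open>T\<close> with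
  fewer than \<open>w\<close> elements.\<close>

lemma card_clique_hang_graph:
  assumes C: "clique_in (hang_graph w N) C"
  shows "card C \<le> w"
proof (cases "C \<subseteq> {..<w}")
  case True
  then show ?thesis using card_mono[of "{..<w}" C] by simp
next
  case False
  with C obtain s where s: "s \<in> C" "s \<in> hangs w N"
    by (auto simp: clique_in_def hang_graph_def)
  then obtain T j where T: "T \<subset> {..<w}" "j < N" and s_eq: "s = hang w T j"
    by (auto simp: hangs_def)
  have "C \<subseteq> insert s T"
  proof
    fix u assume "u \<in> C"
    show "u \<in> insert s T"
    proof (cases "u = s")
      case False
      with C \<open>u \<in> C\<close> s have "(u, s) \<in> parcs (hang_graph w N)"
        by (auto simp: clique_in_def)
      then have "(u, s) \<in> hang_arcs w N"
        using hangs_ge[OF s(2)] by (auto simp: hang_graph_def dest: hang_arcs_range)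
      then show ?thesis using T s_eq hang_arcs_hang_iff by simp
    qed simp
  qed
  then have "card C \<le> card (insert s T)"
    using psubset_lessThan_finite[OF T(1)] by (intro card_mono) auto
  also have "\<dots> \<le> Suc (card T)"
    by (rule card_insert_le_m1) simp_all
  also have "\<dots> \<le> w"
    using card_psubset_lessThan[OF T(1)] by simp
  finally show ?thesis .
qed

lemma clique_number_hang_graph: "clique_number (hang_graph w N) = w"
  unfolding clique_number_def
proof (rule Max_eqI)
  show "finite {card K | K. clique_in (hang_graph w N) K}"
    by (rule finite_subset[of _ "{..w}"]) (auto dest: card_clique_hang_graph)
  show "w \<in> {card K | K. clique_in (hang_graph w N) K}"
    using clique_in_hang_graph[of w N] by force
qed (auto dest: card_clique_hang_graph)

section \<open>The minimum and its lower bound\<close>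

lemma proper_orientation_number_eqI:
  assumes "proper_orientation G D" "k_orientation n G D"
    and "\<And>D k. \<lbrakk>proper_orientation G D; k_orientation k G D\<rbrakk> \<Longrightarrow> n \<le> k"
  shows "proper_orientation_number G = n"
  unfolding proper_orientation_number_def
  by (rule Least_equality) (use assms in blast)+

text \<open>Pigeonhole: a copy that is not a sink sends an arc to a clique vertex, and each of the
  \<open>w\<close> clique vertices receives at most \<open>k\<close> arcs. So at most
  \<open>w * k\<close> of the \<open>N\<close> copies fail.\<close>

lemma sink_hang_exists:
  assumes D: "k_orientation k (hang_graph w N) D"
    and T: "T \<subset> {..<w}" and N: "w * k < N"
  shows "\<exists>j<N. in_degree (with_proj D) (hang w T j) = card T"
proof (rule ccontr)
  assume neg: "\<not> ?thesis"
  interpret G: pair_graph "hang_graph w N" by (rule pair_graph_hang_graph)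
  have or: "orientation_of (hang_graph w N) D"
    using D by (simp add: k_orientation_def)
  then have finD: "finite (parcs D)"
    using finite_subset[OF _ G.pair_finite_arcs] by (simp add: orientation_of_def)
  have finT: "finite T" by (rule psubset_lessThan_finite[OF T])
  define B where "B u = {j. j < N \<and> (hang w T j, u) \<in> parcs D}" for u
  have "{..<N} \<subseteq> (\<Union>u<w. B u)"
  proof
    fix j assume "j \<in> {..<N}"
    then have j: "j < N" by simp
    have arc: "(u, hang w T j) \<in> parcs (hang_graph w N) \<longleftrightarrow> u \<in> T" for u
      using hang_arcs_hang_iff[OF T j, of u]
      by (auto simp: hang_graph_def dest: hang_arcs_range)
    \<comment> \<open>\<open>T\<close> is the whole neighbourhood of the copy, so indegree
      \<open>card T\<close> means being a sink; otherwise some edge to \<open>T\<close> points away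
      from the copy.\<close>
    have "{u. (u, hang w T j) \<in> parcs D} \<noteq> T"
      using neg j by (auto simp: in_degree_eq_card)
    moreover have "{u. (u, hang w T j) \<in> parcs D} \<subseteq> T"
      using or arc by (auto simp: orientation_of_def)
    ultimately obtain u where u: "u \<in> T" "(u, hang w T j) \<notin> parcs D" by auto
    with or arc have "(hang w T j, u) \<in> parcs D"
      by (auto simp: orientation_of_def)
    then show "j \<in> (\<Union>u<w. B u)"
      using u T j by (auto simp: B_def)
  qed
  then have "N \<le> card (\<Union>u<w. B u)"
    using card_mono[of "\<Union>u<w. B u" "{..<N}"] by (simp add: B_def)
  also have "\<dots> \<le> (\<Sum>u<w. card (B u))"
    by (rule card_UN_le) simp
  also have "\<dots> \<le> (\<Sum>u<w. k)"
  proof (rule sum_mono)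
    fix u assume "u \<in> {..<w}"
    have "card (B u) = card (hang w T ` B u)"
      using finT by (simp add: card_image inj_on_def hang_eq_iff)
    also have "\<dots> \<le> card {v. (v, u) \<in> parcs D}"
    proof (rule card_mono)
      show "finite {v. (v, u) \<in> parcs D}"
        by (rule finite_subset[of _ "fst ` parcs D"]) (use finD in \<open>force+\<close>)
    qed (auto simp: B_def)
    also have "\<dots> \<le> k"
      using D \<open>u \<in> {..<w}\<close>
      by (auto simp: k_orientation_def hang_graph_def simp flip: in_degree_eq_card)
    finally show "card (B u) \<le> k" .
  qed
  finally show False using N by simp
qed

text \<open>An indegree \<open>d\<close> in this range allows a proper subset \<open>T\<close> of
  size \<open>d\<close> containing \<open>v\<close>: \<open>1 \<le> d\<close> leaves room for
  \<open>v\<close>, and \<open>d < w\<close> makes \<open>T\<close> proper. A sink copy for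
  \<open>T\<close> is then a neighbour of \<open>v\<close> with the same indegree.\<close>

lemma clique_in_degree_gap:
  assumes D: "proper_orientation (hang_graph w N) D" "k_orientation k (hang_graph w N) D"
    and N: "w * k < N" and v: "v < w"
  shows "in_degree (with_proj D) v \<notin> {1..<w}"
proof
  assume t: "in_degree (with_proj D) v \<in> {1..<w}"
  define d where "d = in_degree (with_proj D) v"
  have d: "1 \<le> d" "d < w" using t by (simp_all add: d_def)
  have "d - 1 \<le> card ({..<w} - {v})"
    using d v by simp
  then obtain S where S: "S \<subseteq> {..<w} - {v}" "card S = d - 1" "finite S"
    by (rule obtain_subset_with_card_n)
  define T where "T = insert v S"
  have "v \<notin> S" using S(1) by blast
  then have card_T: "card T = d"
    using S d by (simp add: T_def)
  then have "T \<noteq> {..<w}" using d by auto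
  moreover have "T \<subseteq> {..<w}" using S(1) v unfolding T_def by blast
  ultimately have T: "T \<subset> {..<w}" by blast
  from sink_hang_exists[OF D(2) T N] obtain j where
    j: "j < N" "in_degree (with_proj D) (hang w T j) = card T" by blast
  have "(v, hang w T j) \<in> hang_arcs w N"
    using hang_arcs_hang_iff[OF T j(1)] by (simp add: T_def)
  then have "(v, hang w T j) \<in> parcs (hang_graph w N)"
    by (simp add: hang_graph_def)
  then show False
    using D(1) j(2) card_T unfolding proper_orientation_def d_def by metis
qed

lemma hang_graph_lower_bound:
  assumes D: "proper_orientation (hang_graph w N) D" "k_orientation k (hang_graph w N) D"
    and w: "1 \<le> w" and N: "w * (2 * w - 2) \<le> N"
  shows "2 * w - 2 \<le> k"
proof (rule ccontr)
  assume "\<not> ?thesis"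
  then have k: "k < 2 * w - 2" by simp
  with w have "w * k < w * (2 * w - 2)" by simp
  with N have wk: "w * k < N" by (rule less_le_trans[rotated])
  have inj: "inj_on (in_degree (with_proj D)) {..<w}"
    using D(1) by (force simp: inj_on_def proper_orientation_def hang_graph_def)
  have "in_degree (with_proj D) ` {..<w} \<subseteq> insert 0 {w..<2 * w - 2}"
  proof
    fix d assume "d \<in> in_degree (with_proj D) ` {..<w}"
    then obtain v where v: "v < w" "d = in_degree (with_proj D) v" by auto
    then have "d \<le> k"
      using D(2) by (auto simp: k_orientation_def hang_graph_def)
    then show "d \<in> insert 0 {w..<2 * w - 2}"
      using clique_in_degree_gap[OF D wk v(1)] k v(2) by auto
  qed
  then have "card (in_degree (with_proj D) ` {..<w}) \<le> card (insert 0 {w..<2 * w - 2})"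
    by (rule card_mono[rotated]) simp
  \<comment> \<open>\<open>k < 2 * w - 2\<close> forces \<open>w \<ge> 2\<close>, so the subtraction
    is not truncated and only \<open>w - 1\<close> values are left for \<open>w\<close> pairwise
    adjacent vertices.\<close>
  also have "\<dots> \<le> Suc (w - 2)"
    by (rule card_insert_le_m1) auto
  finally show False
    using k by (simp add: card_image[OF inj])
qed

section \<open>An orientation attaining the bound\<close>

lemma orientation_of_hang_orientation:
  assumes "w - 1 \<le> N"
  shows "orientation_of (hang_graph w N) (hang_orientation w N)"
proof -
  \<comment> \<open>Arcs of \<open>hang_arcs\<close> cross from below \<open>w\<close> to at least
    \<open>w\<close>. This separates them from their converses and from the clique arcs, so the
    three kinds of edges can be treated independently.\<close>
  have H: "u < w \<and> \<not> v < w" if "(u, v) \<in> hang_arcs w N" for u v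
    using hang_arcs_range[OF that] by simp
  have L: "(u, v) \<in> hang_arcs w N" if "(u, v) \<in> leaf_arcs w" for u v
    using leaf_arcs_subset[OF assms] that by blast
  have sub: "parcs (hang_orientation w N) \<subseteq> parcs (hang_graph w N)"
    using L by (auto simp: hang_graph_def hang_orientation_def)
  have one: "((u, v) \<in> parcs (hang_orientation w N)) \<noteq> ((v, u) \<in> parcs (hang_orientation w N))"
    if "(u, v) \<in> parcs (hang_graph w N)" for u v
  proof -
    consider "u < w" "v < w" "u \<noteq> v" | "(u, v) \<in> hang_arcs w N" | "(v, u) \<in> hang_arcs w N"
      using \<open>(u, v) \<in> parcs (hang_graph w N)\<close> by (auto simp: hang_graph_def)
    then show ?thesis
    proof cases
      case 1
      then have "(u, v) \<notin> hang_arcs w N" "(v, u) \<notin> hang_arcs w N"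
        using H by blast+
      then show ?thesis
        using 1 L by (auto simp: hang_orientation_def)
    next
      case 2
      then have "u < w" "\<not> v < w" "(v, u) \<notin> hang_arcs w N"
        using H by blast+
      then show ?thesis
        using 2 L by (auto simp: hang_orientation_def)
    next
      case 3
      then have "v < w" "\<not> u < w" "(u, v) \<notin> hang_arcs w N"
        using H by blast+
      then show ?thesis
        using 3 L by (auto simp: hang_orientation_def)
    qed
  qed
  show ?thesis
    unfolding orientation_of_def using sub one
    by (simp add: hang_graph_def hang_orientation_def)
qed

text \<open>The smaller clique vertices contribute \<open>v\<close> and the leaves
  \<open>w - 1\<close>. A positive \<open>v\<close> thus gets at least \<open>w\<close>, beyond the
  indegree of every hanging vertex.\<close>

lemma in_degree_hang_orientation_clique:
  assumes N: "w - 1 \<le> N" and v: "v < w"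
  shows "in_degree (with_proj (hang_orientation w N)) v = (if v = 0 then 0 else v + (w - 1))"
proof -
  have arcs: "{u. (u, v) \<in> parcs (hang_orientation w N)} = {..<v} \<union> {s. (v, s) \<in> leaf_arcs w}"
    using v by (auto simp: hang_orientation_def dest: hang_arcs_range)
  show ?thesis
  proof (cases "v = 0")
    case True
    then have "{u. (u, v) \<in> parcs (hang_orientation w N)} = {}"
      unfolding arcs by (auto simp: leaf_arcs_def)
    with True show ?thesis by (simp add: in_degree_eq_card)
  next
    case False
    have leaves: "{s. (v, s) \<in> leaf_arcs w} = hang w {v} ` {..<w - 1}"
      using False v by (auto simp: leaf_arcs_def)
    have "card (hang w {v} ` {..<w - 1}) = w - 1"
      by (subst card_image) (auto simp: inj_on_def hang_eq_iff)
    moreover have "{..<v} \<inter> hang w {v} ` {..<w - 1} = {}"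
      using v by (auto dest: order_less_trans)
    ultimately show ?thesis
      using False by (simp add: in_degree_eq_card arcs leaves card_Un_disjoint)
  qed
qed

text \<open>Reversed leaves are sources, and every other hanging vertex is a sink.\<close>

lemma in_degree_hang_orientation_hang:
  assumes N: "w - 1 \<le> N" and T: "T \<subset> {..<w}" and j: "j < N"
  shows "in_degree (with_proj (hang_orientation w N)) (hang w T j) =
    (if \<exists>u\<ge>1. T = {u} \<and> j < w - 1 then 0 else card T)"
proof -
  have leaf: "(u, hang w T j) \<in> leaf_arcs w \<longleftrightarrow> 1 \<le> u \<and> T = {u} \<and> j < w - 1" for u
    using T by (auto simp: leaf_arcs_def hang_eq_iff psubset_lessThan_finite)
  have "{u. (u, hang w T j) \<in> parcs (hang_orientation w N)} =
      {u \<in> T. \<not> (1 \<le> u \<and> T = {u} \<and> j < w - 1)}"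
    using leaf hang_arcs_hang_iff[OF T j]
    by (auto simp: hang_orientation_def dest: leaf_arcs_range)
  also have "\<dots> = (if \<exists>u\<ge>1. T = {u} \<and> j < w - 1 then {} else T)"
    by auto
  finally show ?thesis
    by (simp only: in_degree_eq_card if_distrib[of card] card.empty)
qed

lemma proper_orientation_hang_orientation:
  assumes N: "w - 1 \<le> N"
  shows "proper_orientation (hang_graph w N) (hang_orientation w N)"
proof -
  let ?d = "in_degree (with_proj (hang_orientation w N))"
  have clique: "?d u \<noteq> ?d v" if "u < w" "v < w" "u \<noteq> v" for u v
    using that by (cases "w = 0") (auto simp: in_degree_hang_orientation_clique[OF N])
  have hang: "?d u \<noteq> ?d s" if us: "(u, s) \<in> hang_arcs w N" for u s
  proof -
    from us obtain T j where T: "s = hang w T j" "T \<subset> {..<w}" "j < N" "u \<in> T"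
      by (rule hang_arcsE)
    \<comment> \<open>If \<open>u = 0\<close>, then \<open>s\<close> is no reversed leaf, and its
      positive indegree differs from 0. If \<open>u > 0\<close>, the indegree of \<open>u\<close> is
      at least \<open>w\<close>, while that of \<open>s\<close> is at most
      \<open>card T < w\<close>.\<close>
    have "0 < card T"
      using T psubset_lessThan_finite by (auto simp: card_gt_0_iff)
    moreover have "u < w" using T by auto
    ultimately show ?thesis
      using T card_psubset_lessThan[OF T(2)]
      by (auto simp: in_degree_hang_orientation_clique[OF N]
          in_degree_hang_orientation_hang[OF N])
  qed
  show ?thesis
    unfolding proper_orientation_def
  proof (intro conjI allI impI orientation_of_hang_orientation[OF N])
    fix u v assume "(u, v) \<in> parcs (hang_graph w N)"
    then show "?d u \<noteq> ?d v"
      using clique[of u v] hang[of u v] hang[of v u] by (auto simp: hang_graph_def)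
  qed
qed

lemma k_orientation_hang_orientation:
  assumes N: "w - 1 \<le> N"
  shows "k_orientation (2 * w - 2) (hang_graph w N) (hang_orientation w N)"
  unfolding k_orientation_def
proof (intro conjI ballI orientation_of_hang_orientation[OF N])
  let ?d = "in_degree (with_proj (hang_orientation w N))"
  fix v assume "v \<in> pverts (hang_graph w N)"
  then consider "v < w" | T j where "T \<subset> {..<w}" "j < N" "v = hang w T j"
    by (auto simp: hang_graph_def hangs_def)
  then show "?d v \<le> 2 * w - 2"
  proof cases
    case 1
    then show ?thesis by (auto simp: in_degree_hang_orientation_clique[OF N])
  next
    case 2
    then show ?thesis
      using card_psubset_lessThan[of T w]
      by (auto simp: in_degree_hang_orientation_hang[OF N])
  qed
qed

theorem theorem16:
  fixes \<omega> :: nat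
  assumes "\<omega> \<ge> 1"
  shows "\<exists>G :: nat pair_pre_digraph. split_graph G \<and> clique_number G = \<omega> \<and>
           proper_orientation_number G = 2 * \<omega> - 2"
proof -
  \<comment> \<open>The lower bound needs \<open>w * k < N\<close> for all
    \<open>k < 2 * w - 2\<close>, and the orientation needs \<open>w - 1\<close> leaves per vertex;
    this value satisfies both. For \<omega> = 1 it is 0, and the graph is a single vertex.\<close>
  define N where "N = \<omega> * (2 * \<omega> - 2)"
  have N: "\<omega> - 1 \<le> N"
  proof -
    have "\<omega> - 1 \<le> 1 * (2 * \<omega> - 2)" by simp
    also have "\<dots> \<le> N"
      unfolding N_def using assms by (rule mult_le_mono1)
    finally show ?thesis .
  qed
  have "proper_orientation_number (hang_graph \<omega> N) = 2 * \<omega> - 2"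
  proof (rule proper_orientation_number_eqI)
    show "2 * \<omega> - 2 \<le> k"
      if "proper_orientation (hang_graph \<omega> N) D" "k_orientation k (hang_graph \<omega> N) D" for D k
      using that assms by (rule hang_graph_lower_bound) (simp add: N_def)
  qed (fact proper_orientation_hang_orientation[OF N] k_orientation_hang_orientation[OF N])+
  then show ?thesis
    using split_graph_hang_graph clique_number_hang_graph by blast
qed

end
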